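(* Let $S\subset\mathbb{N}$ with $|S|=4$. Maker has a $4$-move strategy in the game for $S$ if and only if $S$ is symmetric.
   Context: Game for $S$: for a fixed finite set $S\subset\mathbb{N}$, two players, Maker and Breaker, alternately choose previously unchosen natural numbers, Maker choosing first. Maker wins as soon as the set of Maker's choices contains $aS+b$ for some $a\in\mathbb{N}\setminus\{0\}$ and $b\in\mathbb{Z}$. Maker has an $N$-move strategy if Maker has a strategy guaranteeing a win using at most $N$ selections, whatever Breaker does. For $R,R'\subset\mathbb{Q}$, $R'$ is a copy of $R$ if $R'=aR+b$ for some rational $a>0$ and rational $b$. Writing $S=\{s_1<s_2<s_3<s_4\}$, $S$ is symmetric if there exist $1\le i<j\le 4$ such that $S\setminus\{s_i\}$ is a copy of $S\setminus\{s_j\}$. *)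

theory Defs
  imports Complex_Main
begin

definition is_copy :: "rat set \<Rightarrow> rat set \<Rightarrow> bool" where
  "is_copy R' R \<longleftrightarrow> (\<exists>a b :: rat. a > 0 \<and> R' = (\<lambda>x. a * x + b) ` R)"

text \<open>For \<open>S = {s\<^sub>1 < s\<^sub>2 < s\<^sub>3 < s\<^sub>4}\<close>, choosing indices \<open>i < j\<close> amounts to choosing
  elements \<open>x < y\<close> of \<open>S\<close>.\<close>

definition symmetric :: "nat set \<Rightarrow> bool" where
  "symmetric S \<longleftrightarrow>
     (\<exists>x\<in>S. \<exists>y\<in>S. x < y \<and> is_copy (of_nat ` (S - {x})) (of_nat ` (S - {y})))"

text \<open>The shift \<open>b\<close> may be negative, so the inclusion of \<open>a S + b\<close> is taken in the integers.\<close>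

definition wins_with :: "nat set \<Rightarrow> nat set \<Rightarrow> bool" where
  "wins_with S M \<longleftrightarrow>
     (\<exists>(a::nat) (b::int). a \<noteq> 0 \<and> (\<lambda>s. int a * int s + b) ` S \<subseteq> int ` M)"

text \<open>A strategy maps the chronological list of all numbers chosen so far, by both players, to
  Maker's next choice, which must be previously unchosen.\<close>

definition maker_strategy :: "(nat list \<Rightarrow> nat) \<Rightarrow> bool" where
  "maker_strategy \<sigma> \<longleftrightarrow> (\<forall>h. \<sigma> h \<notin> set h)"

text \<open>A play is the sequence of all choices, Maker's being \<open>p 0, p 2, p 4, \<dots>\<close> and Breaker's
  \<open>p 1, p 3, p 5, \<dots>\<close>. Plays are continued forever, also after a win of Maker; this is
  harmless because later choices do not affect whether Maker has won by a given time.\<close>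

definition play :: "(nat \<Rightarrow> nat) \<Rightarrow> bool" where
  "play p \<longleftrightarrow> inj p"

definition follows :: "(nat list \<Rightarrow> nat) \<Rightarrow> (nat \<Rightarrow> nat) \<Rightarrow> bool" where
  "follows \<sigma> p \<longleftrightarrow> (\<forall>i. p (2 * i) = \<sigma> (map p [0..<2 * i]))"

definition maker_choices :: "(nat \<Rightarrow> nat) \<Rightarrow> nat \<Rightarrow> nat set" where
  "maker_choices p n = {p (2 * i) | i. i < n}"

definition has_move_strategy :: "nat \<Rightarrow> nat set \<Rightarrow> bool" where
  "has_move_strategy N S \<longleftrightarrow>
     (\<exists>\<sigma>. maker_strategy \<sigma> \<and>
        (\<forall>p. play p \<and> follows \<sigma> p \<longrightarrow> (\<exists>n\<le>N. wins_with S (maker_choices p n))))"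

end

theory Submission
  imports Defs
begin

text \<open>Two distinct completions of one triple to copies of \<open>S\<close> exist only if \<open>S\<close> is symmetric, so
  otherwise Breaker's third move blocks Maker's only threat. Conversely, if \<open>S\<close> is symmetric, some
  triple \<open>T\<close> has two completions \<open>u \<noteq> v\<close>, which lie neither on the same side of \<open>T\<close> nor both between
  its outer points. After a first move \<open>m\<^sub>1\<close> and a second one \<open>m\<^sub>2 = m\<^sub>1 + n L\<close>, the pair
  \<open>m\<^sub>1, m\<^sub>2\<close> can play the role of any of the three pairs in \<open>T\<close>. In each role Maker needs three
  numbers to be free: the third point of \<open>T\<close> and both completions. The choice of \<open>n\<close> avoids
  Breaker's first number, and his second one cannot spoil all three roles.\<close>

section \<open>Copies of \<open>S\<close> in the integers\<close>

definition int_copy :: "nat set \<Rightarrow> int set \<Rightarrow> bool" where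
  "int_copy S X \<longleftrightarrow> (\<exists>(a::nat) (b::int). a \<noteq> 0 \<and> (\<lambda>s. int a * int s + b) ` S = X)"

lemma inj_affine: "a \<noteq> 0 \<Longrightarrow> inj_on (\<lambda>s. int a * int s + b) S"
  by (auto simp: inj_on_def)

lemma int_copy_imp_wins_with:
  assumes "int_copy S X" "X \<subseteq> int ` M"
  shows "wins_with S M"
  using assms unfolding int_copy_def wins_with_def by blast

lemma wins_with_mono: "wins_with S M \<Longrightarrow> M \<subseteq> M' \<Longrightarrow> wins_with S M'"
  unfolding wins_with_def by (meson image_mono order_trans)

lemma wins_with_imp_int_copy:
  assumes "wins_with S M" "finite M" "card M \<le> card S"
  shows "int_copy S (int ` M)"
proof -
  obtain a b where ab: "a \<noteq> 0" "(\<lambda>s. int a * int s + b) ` S \<subseteq> int ` M"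
    using assms(1) unfolding wins_with_def by blast
  have "card ((\<lambda>s. int a * int s + b) ` S) = card S"
    using ab(1) by (intro card_image inj_affine)
  moreover have "card (int ` M) = card M"
    by (simp add: card_image)
  ultimately have "(\<lambda>s. int a * int s + b) ` S = int ` M"
    using ab(2) assms(2,3) by (intro card_seteq) auto
  then show ?thesis
    using ab(1) unfolding int_copy_def by blast
qed

lemma int_copy_affine:
  assumes "int_copy S X" "k > 0"
  shows "int_copy S ((\<lambda>x. k * x + c) ` X)"
proof -
  obtain a b where ab: "a \<noteq> 0" "(\<lambda>s. int a * int s + b) ` S = X"
    using assms(1) unfolding int_copy_def by blast
  have "(\<lambda>s. int (nat k * a) * int s + (k * b + c)) ` S = (\<lambda>x. k * x + c) ` X"
    unfolding ab(2)[symmetric] image_image using assms(2) by (simp add: algebra_simps)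
  then show ?thesis
    using ab(1) assms(2) unfolding int_copy_def by (intro exI[of _ "nat k * a"] exI) auto
qed

lemma affine_eq_two_points:
  fixes p q r r' x y :: int
  assumes "q * x + r = p * x + r'" "q * y + r = p * y + r'" "x \<noteq> y"
  shows "q = p \<and> r = r'"
proof -
  have "(q - p) * (x - y) = 0"
    using assms(1,2) by (simp add: algebra_simps)
  then show ?thesis
    using assms by simp
qed

lemma affine_image_Max_Min:
  assumes "finite S" "S \<noteq> {}" "a > 0"
  shows "Max ((\<lambda>s. a * int s + b) ` S) = a * int (Max S) + b"
    and "Min ((\<lambda>s. a * int s + b) ` S) = a * int (Min S) + b"
proof -
  have "mono (\<lambda>s. a * int s + b)"
    using assms(3) by (auto simp: mono_def)
  then show "Max ((\<lambda>s. a * int s + b) ` S) = a * int (Max S) + b"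
    and "Min ((\<lambda>s. a * int s + b) ` S) = a * int (Min S) + b"
    using mono_Max_commute[of "\<lambda>s. a * int s + b" S] mono_Min_commute[of "\<lambda>s. a * int s + b" S] assms
    by auto
qed

text \<open>Positive slope carries \<open>Max S\<close> and \<open>Min S\<close> to the extremes of
  the image. So the two maps agree at two distinct points and hence coincide.\<close>

lemma affine_eq_of_Max_Min:
  assumes "card S \<ge> 2" "q > 0" "p > 0"
    and "Max ((\<lambda>s. q * int s + r) ` S) = Max ((\<lambda>s. p * int s + r') ` S)"
    and "Min ((\<lambda>s. q * int s + r) ` S) = Min ((\<lambda>s. p * int s + r') ` S)"
  shows "q = p \<and> r = r'"
proof -
  have S: "finite S" "S \<noteq> {}"
    using assms(1) by (auto intro: card_ge_0_finite)
  have "Min S \<noteq> Max S"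
  proof
    assume "Min S = Max S"
    then have "S \<subseteq> {Min S}"
      using S by (metis Max_ge Min_le antisym singletonI subsetI)
    then have "card S \<le> 1"
      using card_mono[of "{Min S}" S] by simp
    then show False
      using assms(1) by simp
  qed
  then show ?thesis
    using assms(2-) affine_image_Max_Min[OF S]
    by (intro affine_eq_two_points[of q "int (Max S)" r p r' "int (Min S)"]) auto
qed

section \<open>Symmetry and triples with two completions\<close>

lemma is_copy_sym:
  assumes "is_copy R' R"
  shows "is_copy R R'"
proof -
  obtain a b where ab: "a > 0" "R' = (\<lambda>x. a * x + b) ` R"
    using assms unfolding is_copy_def by blast
  have "R = (\<lambda>x. (1 / a) * x + (- b / a)) ` R'"
    using ab(1) unfolding ab(2) image_image by (simp add: field_simps)
  then show ?thesis
    using ab(1) unfolding is_copy_def by (intro exI[of _ "1 / a"] exI[of _ "- b / a"]) auto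
qed

text \<open>Composing the second map with the rational inverse of the first gives the positive
  affine map from \<open>B\<close> to \<open>A\<close>.\<close>

lemma is_copy_of_affine_images_eq:
  fixes a a' b b' :: int
  assumes "(\<lambda>s. a * int s + b) ` A = (\<lambda>s. a' * int s + b') ` B" "a > 0" "a' > 0"
  shows "is_copy (of_nat ` A) (of_nat ` B)"
proof -
  define c :: rat where "c = of_int a' / of_int a"
  define d :: rat where "d = (of_int b' - of_int b) / of_int a"
  have "(of_nat s :: rat) = c * of_nat s' + d" if "a * int s + b = a' * int s' + b'" for s s'
  proof -
    have "(of_int a * of_nat s + of_int b :: rat) = of_int a' * of_nat s' + of_int b'"
      using arg_cong[OF that, of "of_int :: int \<Rightarrow> rat"] by simp
    then have "of_nat s = (of_int a' * of_nat s' + of_int b' - of_int b) / (of_int a :: rat)"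
      using assms(2) by (simp add: eq_divide_eq algebra_simps)
    then show ?thesis
      by (simp add: c_def d_def add_divide_distrib diff_divide_distrib)
  qed
  then have *: "a * int s + b = a' * int s' + b' \<Longrightarrow> of_nat s = c * of_nat s' + d" for s s' .
  have "of_nat ` A = (\<lambda>x. c * x + d) ` (of_nat ` B)"
  proof (intro equalityI subsetI)
    fix z :: rat assume "z \<in> of_nat ` A"
    then obtain s where s: "s \<in> A" "z = of_nat s" by blast
    then obtain s' where "s' \<in> B" "a * int s + b = a' * int s' + b'"
      using assms(1) by blast
    then show "z \<in> (\<lambda>x. c * x + d) ` (of_nat ` B)"
      using s * by blast
  next
    fix z :: rat assume "z \<in> (\<lambda>x. c * x + d) ` (of_nat ` B)"
    then obtain s' where s': "s' \<in> B" "z = c * of_nat s' + d" by blast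
    then have "a' * int s' + b' \<in> (\<lambda>s. a * int s + b) ` A"
      using assms(1) by blast
    then obtain s where "s \<in> A" "a * int s + b = a' * int s' + b'"
      by force
    then show "z \<in> of_nat ` A"
      using s' * by force
  qed
  moreover have "c > 0"
    using assms(2,3) by (simp add: c_def)
  ultimately show ?thesis
    unfolding is_copy_def by blast
qed

text \<open>Deleting from \<open>S\<close> the preimages of \<open>u\<close> and \<open>v\<close>
  leaves two sets with the same affine image \<open>T\<close>, hence copies of each other. If the
  same point were deleted both times, the two maps would agree on the extremes of the rest, and
  \<open>u = v\<close> would follow.\<close>

lemma symmetric_of_two_completions:
  assumes "card S \<ge> 3" "int_copy S (insert u T)" "int_copy S (insert v T)"
    and "u \<notin> T" "v \<notin> T" "u \<noteq> v"
  shows "symmetric S"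
proof -
  obtain a b where f: "a \<noteq> 0" "(\<lambda>s. int a * int s + b) ` S = insert u T"
    using assms(2) unfolding int_copy_def by blast
  obtain a' b' where g: "a' \<noteq> 0" "(\<lambda>s. int a' * int s + b') ` S = insert v T"
    using assms(3) unfolding int_copy_def by blast
  obtain x where x: "x \<in> S" "u = int a * int x + b"
    using f(2) by blast
  obtain y where y: "y \<in> S" "v = int a' * int y + b'"
    using g(2) by blast
  have fT: "(\<lambda>s. int a * int s + b) ` (S - {x}) = T"
    using f x assms(4) by (subst inj_on_image_set_diff[OF inj_affine[OF f(1), of b UNIV]]) auto
  have gT: "(\<lambda>s. int a' * int s + b') ` (S - {y}) = T"
    using g y assms(5) by (subst inj_on_image_set_diff[OF inj_affine[OF g(1), of b' UNIV]]) auto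
  have copy: "is_copy (of_nat ` (S - {x})) (of_nat ` (S - {y}))"
    using fT gT f(1) g(1) by (intro is_copy_of_affine_images_eq[of "int a" b _ "int a'" b']) auto
  have "x \<noteq> y"
  proof
    assume xy: "x = y"
    have "card (S - {x}) \<ge> 2"
      using assms(1) x(1) by (simp add: card_Diff_singleton)
    then have "int a = int a' \<and> b = b'"
      using f(1) g(1) fT gT xy by (intro affine_eq_of_Max_Min[of "S - {x}"]) auto
    then show False
      using x y xy assms(6) by simp
  qed
  then consider "x < y" | "y < x" by linarith
  then show ?thesis
    using copy is_copy_sym[OF copy] x(1) y(1) unfolding symmetric_def by cases blast+
qed

lemma symmetricE_int:
  assumes "symmetric S"
  obtains x y :: nat and p q r :: int
  where "x \<in> S" "y \<in> S" "x \<noteq> y" "p > 0" "q > 0"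
    "(\<lambda>s. q * int s) ` (S - {x}) = (\<lambda>s. p * int s + r) ` (S - {y})"
proof -
  obtain x y a b where xy: "x \<in> S" "y \<in> S" "x < y" and "a > 0"
    and eq: "of_nat ` (S - {x}) = (\<lambda>z::rat. a * z + b) ` of_nat ` (S - {y})"
    using assms unfolding symmetric_def is_copy_def by blast
  obtain a1 a2 where a: "a = of_int a1 / of_int a2" "a2 > 0"
    using quotient_of_div[of a] quotient_of_denom_pos[of a] by (metis surj_pair)
  obtain b1 b2 where b: "b = of_int b1 / of_int b2" "b2 > 0"
    using quotient_of_div[of b] quotient_of_denom_pos[of b] by (metis surj_pair)
  \<comment> \<open>Multiplying \<open>s = a * s' + b\<close> by the common denominator
    \<open>a2 * b2\<close> gives the integer equation \<open>q * s = p * s' + r\<close>.\<close>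
  define q p r where "q = a2 * b2" and "p = a1 * b2" and "r = b1 * a2"
  have q: "q > 0"
    using a b by (simp add: q_def)
  have p: "p > 0"
    using \<open>a > 0\<close> a b by (simp add: p_def zero_less_divide_iff)
  have key: "(q * int s = p * int s' + r) \<longleftrightarrow> (of_nat s = a * of_nat s' + b)" for s s'
  proof -
    have "(of_int (p * int s' + r) :: rat) = of_int q * (a * of_nat s' + b)"
      using a b by (simp add: q_def p_def r_def field_simps)
    moreover have "(of_int (q * int s) :: rat) = of_int q * of_nat s"
      by simp
    ultimately have "(of_int (q * int s) :: rat) = of_int (p * int s' + r) \<longleftrightarrow>
        of_nat s = a * of_nat s' + b"
      using q by simp
    then show ?thesis
      by (simp only: of_int_eq_iff)
  qed
  have "(\<lambda>s. q * int s) ` (S - {x}) = (\<lambda>s. p * int s + r) ` (S - {y})"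
  proof (intro equalityI subsetI)
    fix z assume "z \<in> (\<lambda>s. q * int s) ` (S - {x})"
    then obtain s where s: "s \<in> S - {x}" "z = q * int s" by blast
    have "(of_nat s :: rat) \<in> (\<lambda>z. a * z + b) ` of_nat ` (S - {y})"
      using s(1) unfolding eq[symmetric] by (rule imageI)
    then obtain s' where "s' \<in> S - {y}" "of_nat s = a * of_nat s' + b"
      by blast
    then show "z \<in> (\<lambda>s. p * int s + r) ` (S - {y})"
      using s(2) key by blast
  next
    fix z assume "z \<in> (\<lambda>s. p * int s + r) ` (S - {y})"
    then obtain s' where s': "s' \<in> S - {y}" "z = p * int s' + r" by blast
    then have "a * of_nat s' + b \<in> of_nat ` (S - {x})"
      unfolding eq by blast
    then obtain s where "s \<in> S - {x}" "of_nat s = a * of_nat s' + b"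
      by force
    then show "z \<in> (\<lambda>s. q * int s) ` (S - {x})"
      using s'(2) key by force
  qed
  then show thesis
    using that[of x y p q r] xy p q by auto
qed

lemma card_3_orderedE:
  fixes T :: "'a::linorder set"
  assumes "card T = 3"
  obtains t1 t2 t3 where "T = {t1, t2, t3}" "t1 < t2" "t2 < t3"
proof -
  have fin: "finite T"
    using assms by (auto intro: card_ge_0_finite)
  obtain x y z where "sorted_list_of_set T = [x, y, z]"
    using assms by (metis length_sorted_list_of_set length_Suc_conv length_0_conv numeral_3_eq_3)
  then show thesis
    using that[of x y z] fin set_sorted_list_of_set[OF fin] strict_sorted_list_of_set[of T] by auto
qed

text \<open>The triple is the common image of the two punctured sets, and \<open>u\<close>,
  \<open>v\<close> are the images of the deleted points. If both lay below (above) the triple, both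
  deleted points would be the minimum (maximum) of \<open>S\<close>. If both lay between its outer
  points, the two images of \<open>S\<close> would share both extremes, so the maps and then the
  deleted points would coincide.\<close>

lemma symmetricE_completions:
  assumes "symmetric S" "card S = 4"
  obtains t1 t2 t3 u v :: int
  where "t1 < t2" "t2 < t3" "u \<notin> {t1, t2, t3}" "v \<notin> {t1, t2, t3}"
    "int_copy S {t1, t2, t3, u}" "int_copy S {t1, t2, t3, v}"
    "\<not> (u < t1 \<and> v < t1)" "\<not> (t3 < u \<and> t3 < v)"
    "\<not> (t1 < u \<and> u < t3 \<and> t1 < v \<and> v < t3)"
proof -
  obtain x y p q r where xy: "x \<in> S" "y \<in> S" "x \<noteq> y" and pos: "p > 0" "q > (0::int)"
    and eq: "(\<lambda>s. q * int s) ` (S - {x}) = (\<lambda>s. p * int s + r) ` (S - {y})"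
    using symmetricE_int[OF assms(1)] by metis
  have fin: "finite S" "S \<noteq> {}"
    using assms(2) by (auto intro: card_ge_0_finite)
  have inj: "inj (\<lambda>s. q * int s)" "inj (\<lambda>s. p * int s + r)"
    using pos by (auto simp: inj_on_def)
  define T where "T = (\<lambda>s. q * int s) ` (S - {x})"
  define u v where "u = q * int x" and "v = p * int y + r"
  have "card T = 3"
    unfolding T_def using assms(2) xy(1) inj(1)
    by (subst card_image) (auto simp: inj_on_def card_Diff_singleton)
  then obtain t1 t2 t3 where T: "T = {t1, t2, t3}" "t1 < t2" "t2 < t3"
    by (rule card_3_orderedE)
  have uT: "u \<notin> T" unfolding T_def u_def using pos by auto
  have vT: "v \<notin> T" unfolding T_def v_def eq using pos by auto
  have Su: "(\<lambda>s. q * int s + 0) ` S = insert u T"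
    unfolding T_def u_def using xy(1) by auto
  have Sv: "(\<lambda>s. p * int s + r) ` S = insert v T"
    unfolding T_def v_def eq using xy(2) by auto
  have cu: "int_copy S (insert u T)"
    using Su pos(2) unfolding int_copy_def by (intro exI[of _ "nat q"] exI[of _ 0]) auto
  have cv: "int_copy S (insert v T)"
    using Sv pos(1) unfolding int_copy_def by (intro exI[of _ "nat p"] exI[of _ r]) auto
  note mm = affine_image_Max_Min[OF fin pos(2), of 0, unfolded Su]
    affine_image_Max_Min[OF fin pos(1), of r, unfolded Sv]
  have "\<not> (u < t1 \<and> v < t1)"
  proof
    assume "u < t1 \<and> v < t1"
    then have "Min (insert u T) = u" "Min (insert v T) = v"
      using T by auto
    then have "x = Min S" "y = Min S"
      using mm pos by (auto simp: u_def v_def)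
    then show False using xy(3) by simp
  qed
  moreover have "\<not> (t3 < u \<and> t3 < v)"
  proof
    assume "t3 < u \<and> t3 < v"
    then have "Max (insert u T) = u" "Max (insert v T) = v"
      using T by auto
    then have "x = Max S" "y = Max S"
      using mm pos by (auto simp: u_def v_def)
    then show False using xy(3) by simp
  qed
  moreover have "\<not> (t1 < u \<and> u < t3 \<and> t1 < v \<and> v < t3)"
  proof
    assume "t1 < u \<and> u < t3 \<and> t1 < v \<and> v < t3"
    then have "Max (insert u T) = t3" "Max (insert v T) = t3"
      "Min (insert u T) = t1" "Min (insert v T) = t1"
      using T by auto
    then have "q = p \<and> 0 = r"
      using assms(2) pos Su Sv by (intro affine_eq_of_Max_Min[of S q p 0 r]) auto
    then have "insert u T = insert v T"
      using Su Sv by simp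
    then have "u = v"
      using uT vT by auto
    then show False
      using \<open>q = p \<and> 0 = r\<close> pos xy(3) by (simp add: u_def v_def)
  qed
  moreover have "insert u T = {t1, t2, t3, u}" "insert v T = {t1, t2, t3, v}"
    using T(1) by auto
  ultimately show thesis
    using that[of t1 t2 t3 u v] T uT vT cu cv by auto
qed

section \<open>Arithmetic of the three roles\<close>

text \<open>The three sets are the positions, relative to Maker's smaller number, of the numbers Maker still
  needs when Maker's two numbers play \<open>(t1, t2)\<close>, \<open>(t1, t3)\<close> and \<open>(t2, t3)\<close>, scaled so that their
  distance is \<open>(t2 - t1) * (t3 - t1) * (t3 - t2)\<close> in all cases.\<close>

lemma no_common_offset:
  fixes t1 t2 t3 u v :: int
  assumes "t1 < t2" "t2 < t3" "u \<notin> {t1, t2, t3}" "v \<notin> {t1, t2, t3}"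
    and below: "\<not> (u < t1 \<and> v < t1)" and above: "\<not> (t3 < u \<and> t3 < v)"
    and between: "\<not> (t1 < u \<and> u < t3 \<and> t1 < v \<and> v < t3)"
    and A: "z \<in> (\<lambda>x. (t3 - t1) * (t3 - t2) * (x - t1)) ` {t3, u, v}"
    and B: "z \<in> (\<lambda>x. (t2 - t1) * (t3 - t2) * (x - t1)) ` {t2, u, v}"
    and C: "z \<in> (\<lambda>x. (t2 - t1) * (t3 - t1) * (x - t2)) ` {t1, u, v}"
  shows False
proof -
  define a b where "a = t2 - t1" and "b = t3 - t2"
  have ab: "a > 0" "b > 0" "t2 - t1 = a" "t3 - t2 = b" "t3 - t1 = a + b"
    "t2 = t1 + a" "t3 = t1 + a + b"
    using assms(1,2) by (auto simp: a_def b_def)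
  obtain xA where xA: "xA \<in> {t3, u, v}" "z = (a + b) * b * (xA - t1)"
    using A unfolding ab(3-5) by blast
  obtain xB where xB: "xB \<in> {t2, u, v}" "z = a * b * (xB - t1)"
    using B unfolding ab(3-5) by blast
  obtain xC where xC: "xC \<in> {t1, u, v}" "z = a * (a + b) * (xC - t2)"
    using C unfolding ab(3-5) by blast
  \<comment> \<open>Geometrically, \<open>xA\<close> is the image of \<open>xB\<close> under the
    contraction centred at \<open>t1\<close> that sends \<open>t3\<close> to \<open>t2\<close>. By
    \<open>BC\<close> below, \<open>xC\<close> is its image under the contraction centred at
    \<open>t3\<close> that sends \<open>t1\<close> to \<open>t2\<close>.\<close>
  have AB: "(a + b) * (xA - t1) = a * (xB - t1)"
  proof -
    have "b * ((a + b) * (xA - t1)) = b * (a * (xB - t1))"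
      using xA(2) xB(2) by (simp add: algebra_simps)
    then show ?thesis using ab(1,2) by simp
  qed
  have BC: "b * (xB - t1) = (a + b) * (xC - t2)"
  proof -
    have "a * (b * (xB - t1)) = a * ((a + b) * (xC - t2))"
      using xC(2) xB(2) by (simp add: algebra_simps)
    then show ?thesis using ab(1,2) by simp
  qed
  \<comment> \<open>Each position of \<open>xB\<close> produces two distinct points, both in
    \<open>{u, v}\<close>, in one forbidden zone: \<open>xA\<close> and \<open>xB\<close> below
    \<open>t1\<close>, \<open>xA\<close> and \<open>xC\<close> on either side of \<open>t2\<close>
    inside the triple, or \<open>xB\<close> and \<open>xC\<close> above \<open>t3\<close>.\<close>
  consider "xB < t1" | "t1 < xB" "xB < t3" | "t3 < xB"
    using xB(1) assms(1-4) by fastforce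
  then show False
  proof cases
    case 1
    then have "a * (xB - t1) < 0"
      using ab by (simp add: mult_pos_neg)
    then have "xA < t1"
      using AB ab by (smt (verit) mult_nonneg_nonneg)
    moreover have "xA \<noteq> xB"
    proof
      assume "xA = xB"
      then have "b * (xB - t1) = 0"
        using AB by (simp add: algebra_simps)
      then show False using 1 ab by simp
    qed
    ultimately show False
      using 1 xA(1) xB(1) assms(1,2) below by auto
  next
    case 2
    have "a * (xB - t1) > 0"
      using ab 2 by simp
    then have 3: "t1 < xA"
      using AB ab by (smt (verit) mult_nonneg_nonpos)
    have "a * (xB - t1) < a * (a + b)"
      using ab 2 by (intro mult_strict_left_mono) auto
    then have "(a + b) * (xA - t1) < (a + b) * a"
      using AB by (simp add: algebra_simps)
    then have 4: "xA < t2"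
      using ab by (simp add: mult_less_cancel_left)
    have "b * (xB - t1) > 0"
      using ab 2 by simp
    then have 5: "t2 < xC"
      using BC ab by (smt (verit) mult_nonneg_nonpos)
    have "b * (xB - t1) < b * (a + b)"
      using ab 2 by (intro mult_strict_left_mono) auto
    then have "(a + b) * (xC - t2) < (a + b) * b"
      using BC by (simp add: algebra_simps)
    then have 6: "xC < t3"
      using ab by (simp add: mult_less_cancel_left)
    show False
      using 3 4 5 6 xA(1) xC(1) assms(1,2) between by auto
  next
    case 3
    have "b * (xB - t1) > b * (a + b)"
      using ab 3 by (intro mult_strict_left_mono) auto
    then have "(a + b) * (xC - t2) > (a + b) * b"
      using BC by (simp add: algebra_simps)
    then have "t3 < xC"
      using ab by (simp add: mult_less_cancel_left)
    moreover have "xB \<noteq> xC"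
    proof
      assume "xB = xC"
      then have "a * (xB - t3) = 0"
        using BC unfolding ab(6,7) by (simp add: algebra_simps)
      then show False using 3 ab(1) by simp
    qed
    ultimately show False
      using 3 xB(1) xC(1) assms(1,2) above by auto
  qed
qed

text \<open>Each \<open>f\<close> rules out at most one factor, namely \<open>z div f\<close>, so
  one of \<open>card F + 1\<close> candidates survives. Here \<open>z\<close> will be the offset of
  Breaker's first number from \<open>m1\<close>.\<close>

lemma exists_multiplier:
  fixes F :: "int set" and z :: int
  assumes "finite F" "z \<noteq> 0"
  obtains n where "n \<in> {1..int (card F) + 1}" "\<And>f. f \<in> F \<Longrightarrow> n * f \<noteq> z"
proof -
  have "\<not> {1..int (card F) + 1} \<subseteq> (\<lambda>f. z div f) ` F"
  proof
    assume "{1..int (card F) + 1} \<subseteq> (\<lambda>f. z div f) ` F"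
    then have "card {1..int (card F) + 1} \<le> card ((\<lambda>f. z div f) ` F)"
      using assms(1) by (intro card_mono) auto
    also have "\<dots> \<le> card F"
      using assms(1) by (rule card_image_le)
    finally show False by simp
  qed
  then obtain n where n: "n \<in> {1..int (card F) + 1}" "n \<notin> (\<lambda>f. z div f) ` F"
    by blast
  have "n * f \<noteq> z" if "f \<in> F" for f
    using n(2) that assms(2) by (metis image_eqI mult_zero_right nonzero_mult_div_cancel_right)
  then show thesis
    using n(1) that by blast
qed

section \<open>Maker's opening and the double threat\<close>

text \<open>\<open>H\<close> stands for Breaker's numbers. After Maker's third move
  \<open>m3\<close>, both \<open>x\<close> and \<open>y\<close> would win, and Breaker's reply can
  take only one of them.\<close>

definition double_threat_available :: "nat set \<Rightarrow> nat \<Rightarrow> nat \<Rightarrow> nat set \<Rightarrow> bool" where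
  "double_threat_available S m1 m2 H \<longleftrightarrow>
    (\<exists>m3 x y. m3 \<notin> insert m1 (insert m2 H) \<and> x \<notin> insert m3 (insert m1 (insert m2 H)) \<and>
      y \<notin> insert x (insert m3 (insert m1 (insert m2 H))) \<and>
      wins_with S {m1, m2, m3, x} \<and> wins_with S {m1, m2, m3, y})"

lemma double_threat:
  fixes k n L o1 o2 w u v :: int and m1 m2 :: nat and H :: "nat set"
  assumes "k > 0" "n > 0" "k * (o2 - o1) = L" "int m2 = int m1 + n * L"
    and dist: "w \<notin> {o1, o2}" "u \<notin> {o1, o2, w}" "v \<notin> {o1, o2, w}" "u \<noteq> v"
    and copies: "int_copy S {o1, o2, w, u}" "int_copy S {o1, o2, w, v}"
    and nonneg: "\<And>x. x \<in> {w, u, v} \<Longrightarrow> int m1 + n * (k * (x - o1)) \<ge> 0"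
    and free: "\<And>x b. x \<in> {w, u, v} \<Longrightarrow> b \<in> H \<Longrightarrow> int b - int m1 \<noteq> n * (k * (x - o1))"
  shows "double_threat_available S m1 m2 H"
proof -
  \<comment> \<open>This is the affine map taking \<open>o1\<close> to \<open>m1\<close> and
    \<open>o2\<close> to \<open>m2\<close>. The images of \<open>w\<close>, \<open>u\<close> and
    \<open>v\<close> are the third move and the two winning numbers.\<close>
  define g where "g x = n * k * x + (int m1 - n * k * o1)" for x
  have g: "g x = int m1 + n * (k * (x - o1))" for x
    by (simp add: g_def algebra_simps)
  have inj: "g x = g y \<longleftrightarrow> x = y" for x y
    using assms(1,2) by (simp add: g_def)
  have g12: "g o1 = int m1" "g o2 = int m2"
    using assms(3,4) by (simp_all add: g)
  have nat_g: "int (nat (g x)) = g x" if "x \<in> {w, u, v}" for x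
    using nonneg[OF that] by (simp add: g)
  have g_free: "nat (g x) \<notin> H" if "x \<in> {w, u, v}" for x
    using free[OF that, of "nat (g x)"] nat_g[OF that] by (auto simp: g)
  have wins: "wins_with S {m1, m2, nat (g w), nat (g x)}"
    if "x \<in> {u, v}" "int_copy S {o1, o2, w, x}" for x
  proof (rule int_copy_imp_wins_with)
    show "int_copy S ((\<lambda>x. n * k * x + (int m1 - n * k * o1)) ` {o1, o2, w, x})"
      using that(2) assms(1,2) by (intro int_copy_affine) auto
    have "g ` {o1, o2, w, x} \<subseteq> int ` {m1, m2, nat (g w), nat (g x)}"
      using g12 nat_g[of w] nat_g[of x] that(1) by auto
    then show "(\<lambda>x. n * k * x + (int m1 - n * k * o1)) ` {o1, o2, w, x}
        \<subseteq> int ` {m1, m2, nat (g w), nat (g x)}"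
      by (simp add: g_def)
  qed
  have ne: "nat (g x) \<noteq> nat (g y)" if "x \<in> {w, u, v}" "y \<in> {w, u, v}" "x \<noteq> y" for x y
    using nat_g[OF that(1)] nat_g[OF that(2)] inj[of x y] that(3) by metis
  have ne': "nat (g x) \<noteq> m1" "nat (g x) \<noteq> m2" if "x \<in> {w, u, v}" for x
    using nat_g[OF that] g12 inj[of x o1] inj[of x o2] that dist by auto
  show ?thesis
    unfolding double_threat_available_def
  proof (intro exI conjI)
    show "wins_with S {m1, m2, nat (g w), nat (g u)}" "wins_with S {m1, m2, nat (g w), nat (g v)}"
      using wins copies by blast+
    have "w \<noteq> u" "w \<noteq> v"
      using dist by auto
    then have "nat (g w) \<noteq> nat (g u)" "nat (g w) \<noteq> nat (g v)" "nat (g u) \<noteq> nat (g v)"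
      using ne dist(4) by blast+
    then show "nat (g w) \<notin> insert m1 (insert m2 H)"
      "nat (g u) \<notin> insert (nat (g w)) (insert m1 (insert m2 H))"
      "nat (g v) \<notin> insert (nat (g u)) (insert (nat (g w)) (insert m1 (insert m2 H)))"
      using g_free[of w] ne'[of w] g_free[of u] ne'[of u] g_free[of v] ne'[of v]
      by (metis insertE insertCI)+
  qed
qed

text \<open>The choices depend on each other in this order: \<open>m1\<close> is large enough for
  every admissible scale \<open>n\<close>, then \<open>n\<close> is fitted to \<open>b1\<close>, and
  only after \<open>b2\<close> is the role of the pair \<open>m1\<close>, \<open>m2\<close>
  decided.\<close>

lemma symmetric_opening:
  assumes "symmetric S" "card S = 4"
  shows "\<exists>m1. \<forall>b1. b1 \<noteq> m1 \<longrightarrow> (\<exists>m2. m2 \<notin> {m1, b1} \<and> (\<forall>b2. b2 \<notin> {m1, b1, m2} \<longrightarrow>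
    double_threat_available S m1 m2 {b1, b2}))"
proof -
  obtain t1 t2 t3 u v where t: "t1 < t2" "t2 < t3" "u \<notin> {t1, t2, t3}" "v \<notin> {t1, t2, t3}"
    and copies: "int_copy S {t1, t2, t3, u}" "int_copy S {t1, t2, t3, v}"
    and zones: "\<not> (u < t1 \<and> v < t1)" "\<not> (t3 < u \<and> t3 < v)"
      "\<not> (t1 < u \<and> u < t3 \<and> t1 < v \<and> v < t3)"
    using symmetricE_completions[OF assms] by metis
  have "u \<noteq> v"
    using t zones by fastforce
  define A B C where "A = (\<lambda>x. (t3 - t1) * (t3 - t2) * (x - t1)) ` {t3, u, v}"
    and "B = (\<lambda>x. (t2 - t1) * (t3 - t2) * (x - t1)) ` {t2, u, v}"
    and "C = (\<lambda>x. (t2 - t1) * (t3 - t1) * (x - t2)) ` {t1, u, v}"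
  define L where "L = (t2 - t1) * (t3 - t1) * (t3 - t2)"
  \<comment> \<open>All offsets from \<open>m1\<close> that may matter, before scaling by
    \<open>n\<close>. Including \<open>L\<close>, the offset of the second move, also keeps
    \<open>m2\<close> away from \<open>b1\<close>.\<close>
  define F where "F = insert L (A \<union> B \<union> C)"
  define N where "N = int (card F) + 1"
  \<comment> \<open>As \<open>N\<close> bounds every scale that \<open>exists_multiplier\<close> can
    return, no number \<open>m1 + n * f\<close> falls below zero.\<close>
  define m1 where "m1 = nat (N * (\<Sum>f\<in>F. \<bar>f\<bar>))"
  have fin: "finite F"
    by (simp add: F_def A_def B_def C_def)
  have "N > 0"
    by (simp add: N_def)
  have L: "L > 0"
    using t by (simp add: L_def)
  have m1: "int m1 + n * f \<ge> 0" if "n \<in> {1..N}" "f \<in> F" for n f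
  proof -
    have "n * \<bar>f\<bar> \<le> N * (\<Sum>f\<in>F. \<bar>f\<bar>)"
      using that fin \<open>N > 0\<close> by (intro mult_mono member_le_sum) auto
    moreover have "n * \<bar>f\<bar> = \<bar>n * f\<bar>"
      using that(1) by (simp add: abs_mult)
    ultimately show ?thesis
      using \<open>N > 0\<close> by (simp add: m1_def sum_nonneg)
  qed
  show ?thesis
  proof (rule exI[of _ m1], intro allI impI)
    fix b1 assume "b1 \<noteq> m1"
    then obtain n where n: "n \<in> {1..N}" "\<And>f. f \<in> F \<Longrightarrow> n * f \<noteq> int b1 - int m1"
      using exists_multiplier[OF fin, of "int b1 - int m1"] unfolding N_def by auto
    define m2 where "m2 = nat (int m1 + n * L)"
    have m2: "int m2 = int m1 + n * L"
      using m1[OF n(1), of L] by (simp add: m2_def F_def)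
    have "n > 0"
      using n(1) by simp
    have "m2 \<noteq> m1"
      using m2 L \<open>n > 0\<close> by auto
    moreover have "m2 \<noteq> b1"
      using m2 n(2)[of L] by (auto simp: F_def)
    moreover have "double_threat_available S m1 m2 {b1, b2}" for b2
    proof -
      \<comment> \<open>One role of the pair: it works as soon as \<open>b2\<close> misses its
        scaled offsets, because the choice of \<open>n\<close> already keeps \<open>b1\<close> off
        all of \<open>F\<close>.\<close>
      have threat: ?thesis
        if "k > 0" "k * (o2 - o1) = L" "{o1, o2, w} = {t1, t2, t3}" "w \<notin> {o1, o2}"
          and sub: "(\<lambda>x. k * (x - o1)) ` {w, u, v} \<subseteq> F"
          and b2: "int b2 - int m1 \<notin> (\<lambda>f. n * f) ` (\<lambda>x. k * (x - o1)) ` {w, u, v}"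
        for k o1 o2 w
      proof (rule double_threat[OF that(1) \<open>n > 0\<close> that(2) m2 that(4)])
        have ins: "{o1, o2, w, x} = {t1, t2, t3, x}" for x
          using that(3) by auto
        show "u \<notin> {o1, o2, w}" "v \<notin> {o1, o2, w}"
          unfolding that(3) using t by auto
        show "u \<noteq> v" by fact
        show "int_copy S {o1, o2, w, u}" "int_copy S {o1, o2, w, v}"
          unfolding ins by fact+
        show "int m1 + n * (k * (x - o1)) \<ge> 0" if "x \<in> {w, u, v}" for x
          using m1[OF n(1)] sub that by blast
        show "int b - int m1 \<noteq> n * (k * (x - o1))" if "x \<in> {w, u, v}" "b \<in> {b1, b2}" for x b
        proof -
          have "k * (x - o1) \<in> F"
            using sub that(1) by blast
          then have "n * (k * (x - o1)) \<noteq> int b1 - int m1"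
            by (rule n(2))
          moreover have "n * (k * (x - o1)) \<noteq> int b2 - int m1"
            using b2 imageI[OF imageI[OF that(1)]] by metis
          ultimately show ?thesis
            using that(2) by auto
        qed
      qed
      \<comment> \<open>Cancelling \<open>n\<close> turns a hit in all three roles into one offset
        common to \<open>A\<close>, \<open>B\<close> and \<open>C\<close>.\<close>
      have "\<not> (int b2 - int m1 \<in> (\<lambda>f. n * f) ` A \<and> int b2 - int m1 \<in> (\<lambda>f. n * f) ` B \<and>
        int b2 - int m1 \<in> (\<lambda>f. n * f) ` C)"
      proof
        assume *: "int b2 - int m1 \<in> (\<lambda>f. n * f) ` A \<and> int b2 - int m1 \<in> (\<lambda>f. n * f) ` B \<and>
          int b2 - int m1 \<in> (\<lambda>f. n * f) ` C"
        then obtain z where z: "int b2 - int m1 = n * z" "z \<in> A" by blast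
        have "z \<in> B" "z \<in> C"
          using * \<open>n > 0\<close> unfolding z(1) by auto
        then show False
          using no_common_offset[OF t zones] z(2) unfolding A_def B_def C_def by blast
      qed
      then consider "int b2 - int m1 \<notin> (\<lambda>f. n * f) ` A" | "int b2 - int m1 \<notin> (\<lambda>f. n * f) ` B"
        | "int b2 - int m1 \<notin> (\<lambda>f. n * f) ` C" by blast
      then show ?thesis
      proof cases
        case 1
        show ?thesis
        proof (rule threat[of "(t3 - t1) * (t3 - t2)" t2 t1 t3])
          show "0 < (t3 - t1) * (t3 - t2)" "{t1, t2, t3} = {t1, t2, t3}" "t3 \<notin> {t1, t2}"
            using t by auto
          show "(t3 - t1) * (t3 - t2) * (t2 - t1) = L"
            by (simp add: L_def mult_ac)
        qed (use 1 in \<open>unfold A_def[symmetric] F_def, blast+\<close>)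
      next
        case 2
        show ?thesis
        proof (rule threat[of "(t2 - t1) * (t3 - t2)" t3 t1 t2])
          show "0 < (t2 - t1) * (t3 - t2)" "{t1, t3, t2} = {t1, t2, t3}" "t2 \<notin> {t1, t3}"
            using t by auto
          show "(t2 - t1) * (t3 - t2) * (t3 - t1) = L"
            by (simp add: L_def mult_ac)
        qed (use 2 in \<open>unfold B_def[symmetric] F_def, blast+\<close>)
      next
        case 3
        show ?thesis
        proof (rule threat[of "(t2 - t1) * (t3 - t1)" t3 t2 t1])
          show "0 < (t2 - t1) * (t3 - t1)" "{t2, t3, t1} = {t1, t2, t3}" "t1 \<notin> {t2, t3}"
            using t by auto
          show "(t2 - t1) * (t3 - t1) * (t3 - t2) = L"
            by (simp add: L_def mult_ac)
        qed (use 3 in \<open>unfold C_def[symmetric] F_def, blast+\<close>)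
      qed
    qed
    ultimately show "\<exists>m2. m2 \<notin> {m1, b1} \<and> (\<forall>b2. b2 \<notin> {m1, b1, m2} \<longrightarrow>
      double_threat_available S m1 m2 {b1, b2})"
      by (intro exI[of _ m2]) auto
  qed
qed

section \<open>From forced wins to strategies\<close>

text \<open>Maker, to move after the choices \<open>h\<close>, can enforce \<open>W\<close> after \<open>k\<close> more moves of each player.\<close>

fun forces :: "(nat list \<Rightarrow> bool) \<Rightarrow> nat \<Rightarrow> nat list \<Rightarrow> bool" where
  "forces W 0 h \<longleftrightarrow> W h"
| "forces W (Suc k) h \<longleftrightarrow>
    (\<exists>x. x \<notin> set h \<and> (\<forall>y. y \<notin> insert x (set h) \<longrightarrow> forces W k (h @ [x, y])))"

lemma fresh_nat: "\<exists>x::nat. x \<notin> set h"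
  using ex_new_if_finite[OF infinite_UNIV_nat finite_set] .

lemma forces_imp_strategy:
  assumes "forces W N []"
  shows "\<exists>\<sigma>. maker_strategy \<sigma> \<and> (\<forall>p. play p \<and> follows \<sigma> p \<longrightarrow> W (map p [0..<2 * N]))"
proof -
  \<comment> \<open>\<open>length h div 2\<close> rounds are complete at \<open>h\<close>. The
    current one is counted by the \<open>Suc\<close>, so the subtraction leaves the rounds after
    it.\<close>
  define good where "good h x \<longleftrightarrow> x \<notin> set h \<and>
    (\<forall>y. y \<notin> insert x (set h) \<longrightarrow> forces W (N - Suc (length h div 2)) (h @ [x, y]))" for h x
  define \<sigma> where "\<sigma> h = (if \<exists>x. good h x then SOME x. good h x else SOME x. x \<notin> set h)" for h
  have good: "good h (\<sigma> h)" if "\<exists>x. good h x" for h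
    using someI_ex[OF that] that by (simp add: \<sigma>_def)
  have "maker_strategy \<sigma>"
    unfolding maker_strategy_def
  proof
    fix h
    show "\<sigma> h \<notin> set h"
    proof (cases "\<exists>x. good h x")
      case True
      then show ?thesis using good[OF True] by (simp add: good_def)
    next
      case False
      then show ?thesis using someI_ex[OF fresh_nat[of h]] by (simp add: \<sigma>_def)
    qed
  qed
  moreover have "W (map p [0..<2 * N])" if p: "play p" "follows \<sigma> p" for p
  proof -
    have "forces W (N - i) (map p [0..<2 * i])" if "i \<le> N" for i
      using that
    proof (induction i)
      case 0
      then show ?case using assms by simp
    next
      case (Suc i)
      define h where "h = map p [0..<2 * i]"
      have "forces W (Suc (N - Suc i)) h"
        using Suc by (simp add: h_def Suc_diff_Suc)
      then have "\<exists>x. good h x"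
        by (simp add: good_def h_def)
      from good[OF this] have "good h (p (2 * i))"
        using p(2) by (simp add: follows_def h_def)
      moreover have "p (Suc (2 * i)) \<notin> insert (p (2 * i)) (set h)"
        using p(1) by (auto simp: play_def h_def inj_eq)
      ultimately have "forces W (N - Suc i) (h @ [p (2 * i), p (Suc (2 * i))])"
        by (simp add: good_def h_def)
      moreover have "h @ [p (2 * i), p (Suc (2 * i))] = map p [0..<2 * Suc i]"
        by (simp add: h_def)
      ultimately show ?case by simp
    qed
    from this[of N] show ?thesis by simp
  qed
  ultimately show ?thesis by blast
qed

lemma maker_choices_4: "maker_choices p 4 = {p 0, p 2, p 4, p 6}"
proof -
  have "{i. i < (4::nat)} = {0, 1, 2, 3}" by auto
  moreover have "maker_choices p 4 = (\<lambda>i. p (2 * i)) ` {i. i < 4}"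
    unfolding maker_choices_def by auto
  ultimately show ?thesis by simp
qed

lemma symmetric_imp_strategy:
  assumes "symmetric S" "card S = 4"
  shows "has_move_strategy 4 S"
proof -
  \<comment> \<open>Maker's moves sit at even positions, so position 6 is the fourth.
    \<open>W\<close> is tested after four full rounds, and Breaker's last reply does not affect
    it.\<close>
  define W where "W h \<longleftrightarrow> wins_with S {h ! 0, h ! 2, h ! 4, h ! 6}" for h
  obtain m1 where m1: "\<And>b1. b1 \<noteq> m1 \<Longrightarrow> (\<exists>m2. m2 \<notin> {m1, b1} \<and> (\<forall>b2. b2 \<notin> {m1, b1, m2} \<longrightarrow>
    double_threat_available S m1 m2 {b1, b2}))"
    using symmetric_opening[OF assms] by blast
  \<comment> \<open>The labels \<open>3\<close>, \<open>2\<close> and \<open>1\<close> count the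
    rounds already played; the argument runs backwards from the end of the game.\<close>
  have 3: "forces W (Suc 0) [m1, b1, m2, b2, m3, b3]"
    if "x \<notin> {m1, b1, m2, b2, m3, b3}" "wins_with S {m1, m2, m3, x}" for b1 m2 b2 m3 b3 x
    using that by (auto simp: W_def intro!: exI[of _ x])
  have 2: "forces W (Suc (Suc 0)) [m1, b1, m2, b2]"
    if "m3 \<notin> {m1, b1, m2, b2}" "x \<notin> {m1, b1, m2, b2, m3}" "y \<notin> {m1, b1, m2, b2, m3, x}"
      "wins_with S {m1, m2, m3, x}" "wins_with S {m1, m2, m3, y}" for b1 m2 b2 m3 x y
  proof -
    have "forces W (Suc 0) [m1, b1, m2, b2, m3, b3]" if "b3 \<notin> {m1, b1, m2, b2, m3}" for b3
      using 3[of x b1 m2 b2 m3 b3] 3[of y b1 m2 b2 m3 b3]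
        \<open>x \<notin> _\<close> \<open>y \<notin> _\<close> \<open>wins_with S {m1, m2, m3, x}\<close> \<open>wins_with S {m1, m2, m3, y}\<close>
      by (cases "b3 = x") auto
    then show ?thesis
      using that(1) by (subst forces.simps) (auto simp del: forces.simps intro!: exI[of _ m3])
  qed
  have 1: "forces W (Suc (Suc (Suc 0))) [m1, b1]" if "b1 \<noteq> m1" for b1
  proof -
    obtain m2 where m2: "m2 \<notin> {m1, b1}" "\<And>b2. b2 \<notin> {m1, b1, m2} \<Longrightarrow>
        double_threat_available S m1 m2 {b1, b2}"
      using m1[OF \<open>b1 \<noteq> m1\<close>] by blast
    have "forces W (Suc (Suc 0)) [m1, b1, m2, b2]" if b2: "b2 \<notin> {m1, b1, m2}" for b2
    proof -
      obtain m3 x y where "m3 \<notin> insert m1 (insert m2 {b1, b2})"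
        "x \<notin> insert m3 (insert m1 (insert m2 {b1, b2}))"
        "y \<notin> insert x (insert m3 (insert m1 (insert m2 {b1, b2})))"
        "wins_with S {m1, m2, m3, x}" "wins_with S {m1, m2, m3, y}"
        using m2(2)[OF b2] unfolding double_threat_available_def by blast
      then show ?thesis by (intro 2[of m3 b1 m2 b2 x y]) auto
    qed
    then show ?thesis
      using m2(1) by (subst forces.simps) (auto simp del: forces.simps intro!: exI[of _ m2])
  qed
  have "forces W (Suc (Suc (Suc (Suc 0)))) []"
    using 1 by (subst forces.simps) (auto simp del: forces.simps intro!: exI[of _ m1])
  then have "forces W 4 []"
    by (simp add: numeral_eq_Suc del: forces.simps)
  then obtain \<sigma> where \<sigma>: "maker_strategy \<sigma>"
    "\<And>p. play p \<and> follows \<sigma> p \<Longrightarrow> W (map p [0..<2 * 4])"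
    using forces_imp_strategy by blast
  have "wins_with S (maker_choices p 4)" if "play p \<and> follows \<sigma> p" for p
    using \<sigma>(2)[OF that] by (simp add: W_def maker_choices_4 numeral_2_eq_2)
  then show ?thesis
    using \<sigma>(1) unfolding has_move_strategy_def by blast
qed

section \<open>Breaker's blocking strategy\<close>

primrec history :: "(nat list \<Rightarrow> nat) \<Rightarrow> nat \<Rightarrow> nat list" where
  "history f 0 = []"
| "history f (Suc n) = history f n @ [f (history f n)]"

lemma history_eq_map: "history f n = map (\<lambda>i. f (history f i)) [0..<n]"
  by (induction n) auto

text \<open>The two strategies are run against each other by recursion on the whole history. The
  play is injective because each move differs from all earlier ones.\<close>

lemma strategies_play:
  assumes "maker_strategy \<sigma>" "\<And>h. \<beta> h \<notin> set h"
  obtains p where "play p" "follows \<sigma> p" "\<And>i. p (Suc (2 * i)) = \<beta> (map p [0..<Suc (2 * i)])"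
proof -
  define f where "f h = (if even (length h) then \<sigma> h else \<beta> h)" for h
  define p where "p i = f (history f i)" for i
  have hist: "history f n = map p [0..<n]" for n
    using history_eq_map[of f n] by (simp add: p_def)
  have p: "p n = f (map p [0..<n])" for n
    unfolding hist[symmetric] by (rule p_def)
  have new: "p n \<notin> p ` {..<n}" for n
  proof -
    have "f h \<notin> set h" for h
      using assms by (simp add: f_def maker_strategy_def)
    from this[of "map p [0..<n]"] show ?thesis
      unfolding p[symmetric] by (simp add: atLeast0LessThan)
  qed
  have "play p"
    unfolding play_def proof (rule linorder_injI)
    fix i j :: nat assume "i < j"
    then have "p i \<in> p ` {..<j}" by simp
    then show "p i \<noteq> p j" using new[of j] by metis
  qed
  moreover have "p (2 * i) = \<sigma> (map p [0..<2 * i])" for i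
    by (subst p) (simp add: f_def)
  moreover have "p (Suc (2 * i)) = \<beta> (map p [0..<Suc (2 * i)])" for i
    by (subst p) (simp add: f_def)
  ultimately show thesis
    using that[of p] unfolding follows_def by blast
qed

text \<open>Breaker takes a number that completes Maker's first three to a win whenever one is free.
  Maker still wins with the fourth move, so the triple has two different completions.\<close>

lemma strategy_imp_symmetric:
  assumes "has_move_strategy 4 S" "card S = 4"
  shows "symmetric S"
proof -
  obtain \<sigma> where \<sigma>: "maker_strategy \<sigma>"
    "\<And>p. play p \<and> follows \<sigma> p \<Longrightarrow> \<exists>n\<le>4. wins_with S (maker_choices p n)"
    using assms(1) unfolding has_move_strategy_def by blast
  \<comment> \<open>The condition matters only for histories of length 5, when Maker's first three
    numbers are at positions 0, 2 and 4 and Breaker makes the third reply.\<close>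
  define threat where "threat h x \<longleftrightarrow> x \<notin> set h \<and> wins_with S {h ! 0, h ! 2, h ! 4, x}" for h x
  define \<beta> where "\<beta> h = (if \<exists>x. threat h x then SOME x. threat h x else SOME x. x \<notin> set h)" for h
  have \<beta>: "threat h (\<beta> h)" if "\<exists>x. threat h x" for h
    using someI_ex[OF that] that by (simp add: \<beta>_def)
  have "\<beta> h \<notin> set h" for h
  proof (cases "\<exists>x. threat h x")
    case True
    then show ?thesis using \<beta>[OF True] by (simp add: threat_def)
  next
    case False
    then show ?thesis using someI_ex[OF fresh_nat[of h]] by (simp add: \<beta>_def)
  qed
  then obtain p where p: "play p" "follows \<sigma> p" "\<And>i. p (Suc (2 * i)) = \<beta> (map p [0..<Suc (2 * i)])"
    using strategies_play[OF \<sigma>(1)] by metis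
  have inj: "p i = p j \<longleftrightarrow> i = j" for i j
    using p(1) by (auto simp: play_def inj_eq)
  define h where "h = map p [0..<5]"
  have h: "h ! 0 = p 0" "h ! 2 = p 2" "h ! 4 = p 4"
    by (simp_all add: h_def numeral_2_eq_2)
  obtain n where "n \<le> 4" "wins_with S (maker_choices p n)"
    using \<sigma>(2) p(1,2) by blast
  moreover from this(1) have "maker_choices p n \<subseteq> maker_choices p 4"
    unfolding maker_choices_def by auto
  ultimately have win6: "wins_with S {p 0, p 2, p 4, p 6}"
    using wins_with_mono by (metis maker_choices_4)
  \<comment> \<open>Maker's later number \<open>p 6\<close> was already a threat when Breaker moved,
    so Breaker's rule must have picked a threat as \<open>p 5\<close>.\<close>
  then have "threat h (p 6)"
    unfolding threat_def h by (auto simp: h_def inj)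
  moreover have "p 5 = \<beta> h"
    using p(3)[of 2] by (simp add: h_def)
  ultimately have win5: "wins_with S {p 0, p 2, p 4, p 5}"
    using \<beta>[of h] unfolding threat_def h by auto
  define T where "T = int ` {p 0, p 2, p 4}"
  have "int_copy S (insert (int (p i)) T)" if "i \<in> {5, 6}" for i
  proof -
    have "card {p 0, p 2, p 4, p i} \<le> card S"
      using card_length[of "[p 0, p 2, p 4, p i]"] by (simp add: assms(2))
    moreover have "wins_with S {p 0, p 2, p 4, p i}"
      using that win5 win6 by auto
    ultimately have "int_copy S (int ` {p 0, p 2, p 4, p i})"
      by (intro wins_with_imp_int_copy) auto
    moreover have "int ` {p 0, p 2, p 4, p i} = insert (int (p i)) T"
      unfolding T_def by auto
    ultimately show ?thesis by simp
  qed
  then show ?thesis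
    using assms(2) by (intro symmetric_of_two_completions[of S "int (p 5)" T "int (p 6)"])
      (auto simp: T_def inj)
qed

theorem theorem4p1:
  fixes S :: "nat set"
  assumes "card S = 4"
  shows "has_move_strategy 4 S \<longleftrightarrow> symmetric S"
  using strategy_imp_symmetric symmetric_imp_strategy assms by blast

end
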